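(* Consider the two-shop ski rental problem with renting prices $1=r_1<r_2$ and buying prices $b_1>b_2>0$. Let $m$ be the number of predictions, and let $\lambda\in(0,1)$ be a hyperparameter. Let $x$ be the actual number of skiing days, let $y_1<y_2<\cdots<y_m$ be the predicted numbers of skiing days, let $z$ be the number of indices $i\in\{1,\dots,m\}$ with $y_i\ge b_2$, and let $\zeta=\max_{i}|y_i-x|$. Consider the randomized algorithm that, given $y_1,\dots,y_m$: - if $z\ge m/2$, sets $k=\left\lfloor\frac{\lambda b_2}{2z-m+1}\right\rfloor$, chooses $j\in\{1,\dots,k\}$ randomly from the distribution $$p_i=\left(\frac{b_2-r_2}{b_2}\right)^{k-i}\cdot\frac{r_2}{b_2\left(1-\left(1-\frac{r_2}{b_2}\right)^{k}\right)},\qquad i=1,\dots,k,$$ rents till day $j-1$ and then buys on day $j$ at shop $2$; - otherwise, sets $l=\left\lceil\frac{m-2z+1}{\lambda}\,b_1\right\rceil$, chooses $j\in\{1,\dots,l\}$ randomly from the distribution $$q_i=\left(\frac{b_1-1}{b_1}\right)^{l-i}\cdot\frac{1}{b_1\left(1-\left(1-\frac{1}{b_1}\right)^{l}\right)},\qquad i=1,\dots,l,$$ rents till day $j-1$ and then buys on day $j$ at shop $1$. Then the competitive ratio of this algorithm is at most $$\min\left\{\frac{b_1}{b_2}\max\left\{\frac{r_2}{1-e^{-r_2\left(\frac{\lambda}{m+1}-\frac{1}{b_2}\right)}},\ \frac{\frac{m+1}{\lambda}+\frac{1}{b_1}}{1-e^{-1/\lambda}}\right\},\ \ \frac{r_2\lambda}{1-e^{-r_2\lambda/(m+1)}}\left(1+\frac{\zeta}{\mathrm{OPT}}\right)\right\}.$$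 In particular, the algorithm is $\left(\frac{r_2\lambda}{1-e^{-r_2\lambda/(m+1)}}\right)$-consistent and $\left(\frac{b_1}{b_2}\max\left\{\frac{r_2}{1-e^{-r_2\left(\frac{\lambda}{m+1}-\frac{1}{b_2}\right)}},\frac{\frac{m+1}{\lambda}+\frac{1}{b_1}}{1-e^{-1/\lambda}}\right\}\right)$-robust.
   Context: A skier skis for a number $x$ of days that is unknown to the algorithm. Shop $s\in\{1,2\}$ rents skis for $r_s$ dollars per day and sells them for $b_s$ dollars. The skier must choose one shop as soon as she starts skiing and must rent or buy at that particular shop from then on. Choosing shop $s$ and buying on day $d\in\{1,2,\dots\}$ costs $x\,r_s$ if $x<d$ and $(d-1)r_s+b_s$ if $x\ge d$. $\mathrm{ALG}$ is the (random) cost of the algorithm; $\mathrm{OPT}=\min\{x,b_2\}$ is the offline optimal cost (with $x$ known). The predictions $y_1<\cdots<y_m$ are given to the algorithm; $\zeta=\max_i|y_i-x|$ is the prediction error, which the algorithm does not know. The competitive ratio is the ratio of $\mathbb{E}[\mathrm{ALG}]$ to $\mathrm{OPT}$, in the worst case over all feasible inputs; the bound depending on $\zeta$ means that $\mathbb{E}[\mathrm{ALG}]/\mathrm{OPT}$ is at most the stated quantity for all $x$ and all predictions. The expectation is over the random choice of $j$, with $x$ and the predictions fixed. A randomized algorithm is $\alpha$-consistent if $\mathbb{E}[\mathrm{ALG}]\le\alpha\cdot\mathrm{OPT}$ whenever $\zeta=0$, and $\beta$-robust if $\mathbb{E}[\mathrm{ALG}]\le\beta\cdot\mathrm{OPT}$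 for all $\zeta$ and all feasible outcomes of the problem.
   Formalization: It is assumed that for every prediction vector the p_i (resp. q_i) form a probability distribution (in particular k≥1, so λb_2≥m+1); otherwise, e.g. m=1, λ=1/2, b_2=2, z=1, one has k=0 and the algorithm is undefined. Also m≥1, and x≥1 where the ratio to OPT is taken. *)

theory Defs
  imports "HOL-Probability.Probability"
begin

text \<open>
  Shops are the numbers 1 and 2; \<open>r s\<close> and \<open>b s\<close> are the daily rent and the purchase price at
  shop \<open>s\<close>. A vector of \<open>m\<close> predictions is a function \<open>y\<close> of which only the values on \<open>{1..m}\<close>
  matter. A strategy is a pair of a shop and a buying day.
\<close>

definition ski_cost :: "(nat \<Rightarrow> real) \<Rightarrow> (nat \<Rightarrow> real) \<Rightarrow> nat \<Rightarrow> nat \<times> nat \<Rightarrow> real" where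
  "ski_cost r b x = (\<lambda>(s, d). if x < d then real x * r s else (real d - 1) * r s + b s)"

definition ski_opt :: "(nat \<Rightarrow> real) \<Rightarrow> nat \<Rightarrow> real" where
  "ski_opt b x = min (real x) (b 2)"

definition predictions :: "nat \<Rightarrow> (nat \<Rightarrow> real) \<Rightarrow> bool" where
  "predictions m y \<longleftrightarrow> strict_mono_on {1..m} y"

definition pred_error :: "nat \<Rightarrow> (nat \<Rightarrow> real) \<Rightarrow> nat \<Rightarrow> real" where
  "pred_error m y x = Max ((\<lambda>i. \<bar>y i - real x\<bar>) ` {1..m})"

definition expected_cost :: "(nat \<Rightarrow> real) \<Rightarrow> (nat \<Rightarrow> real) \<Rightarrow> (nat \<times> nat) pmf \<Rightarrow> nat \<Rightarrow> real" where
  "expected_cost r b S x = measure_pmf.expectation S (ski_cost r b x)"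

text \<open>
  A randomized algorithm maps a prediction vector to a distribution over strategies.
\<close>

definition consistent ::
  "(nat \<Rightarrow> real) \<Rightarrow> (nat \<Rightarrow> real) \<Rightarrow> nat \<Rightarrow> ((nat \<Rightarrow> real) \<Rightarrow> (nat \<times> nat) pmf) \<Rightarrow> real \<Rightarrow> bool" where
  "consistent r b m A \<alpha> \<longleftrightarrow>
     (\<forall>x y. predictions m y \<longrightarrow> pred_error m y x = 0 \<longrightarrow>
        expected_cost r b (A y) x \<le> \<alpha> * ski_opt b x)"

definition robust ::
  "(nat \<Rightarrow> real) \<Rightarrow> (nat \<Rightarrow> real) \<Rightarrow> nat \<Rightarrow> ((nat \<Rightarrow> real) \<Rightarrow> (nat \<times> nat) pmf) \<Rightarrow> real \<Rightarrow> bool" where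
  "robust r b m A \<beta> \<longleftrightarrow>
     (\<forall>x y. predictions m y \<longrightarrow> expected_cost r b (A y) x \<le> \<beta> * ski_opt b x)"

definition prob_weights :: "nat \<Rightarrow> (nat \<Rightarrow> real) \<Rightarrow> bool" where
  "prob_weights n w \<longleftrightarrow> (\<forall>i\<in>{1..n}. 0 \<le> w i) \<and> (\<Sum>i=1..n. w i) = 1"

text \<open>Meaningful only if \<open>prob_weights n w\<close>; otherwise the value is unspecified.\<close>

definition weights_pmf :: "nat \<Rightarrow> (nat \<Rightarrow> real) \<Rightarrow> nat pmf" where
  "weights_pmf n w = embed_pmf (\<lambda>i. if i \<in> {1..n} then w i else 0)"

text \<open>
  The weights \<open>p\<^sub>i\<close> are the instance \<open>\<rho> = r 2\<close>, \<open>\<beta> = b 2\<close>, \<open>n = k\<close>, and the weights \<open>q\<^sub>i\<close> are the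
  instance \<open>\<rho> = 1\<close>, \<open>\<beta> = b 1\<close>, \<open>n = l\<close>.
\<close>

definition buy_weight :: "real \<Rightarrow> real \<Rightarrow> nat \<Rightarrow> nat \<Rightarrow> real" where
  "buy_weight \<rho> \<beta> n i = ((\<beta> - \<rho>) / \<beta>) ^ (n - i) * (\<rho> / (\<beta> * (1 - (1 - \<rho> / \<beta>) ^ n)))"

definition num_ge :: "(nat \<Rightarrow> real) \<Rightarrow> nat \<Rightarrow> (nat \<Rightarrow> real) \<Rightarrow> nat" where
  "num_ge b m y = card {i\<in>{1..m}. b 2 \<le> y i}"

definition horizon2 :: "(nat \<Rightarrow> real) \<Rightarrow> nat \<Rightarrow> real \<Rightarrow> nat \<Rightarrow> nat" where
  "horizon2 b m lam z = nat \<lfloor>lam * b 2 / (2 * real z - real m + 1)\<rfloor>"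

definition horizon1 :: "(nat \<Rightarrow> real) \<Rightarrow> nat \<Rightarrow> real \<Rightarrow> nat \<Rightarrow> nat" where
  "horizon1 b m lam z = nat \<lceil>(real m - 2 * real z + 1) / lam * b 1\<rceil>"

definition ski_alg ::
  "(nat \<Rightarrow> real) \<Rightarrow> (nat \<Rightarrow> real) \<Rightarrow> nat \<Rightarrow> real \<Rightarrow> (nat \<Rightarrow> real) \<Rightarrow> (nat \<times> nat) pmf" where
  "ski_alg r b m lam y =
     (let z = num_ge b m y; k = horizon2 b m lam z; l = horizon1 b m lam z
      in if real z \<ge> real m / 2
         then map_pmf (\<lambda>j. (2, j)) (weights_pmf k (buy_weight (r 2) (b 2) k))
         else map_pmf (\<lambda>j. (1, j)) (weights_pmf l (buy_weight 1 (b 1) l)))"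

text \<open>
  The sampling step of the algorithm makes sense only if the prescribed weights are a probability
  distribution on \<open>{1..k}\<close> (respectively \<open>{1..l}\<close>). This can fail, for instance if \<open>k = 0\<close>, or if
  \<open>r 2 > b 2\<close>, when some weights are negative for \<open>k > 1\<close>.
\<close>

definition ski_alg_defined ::
  "(nat \<Rightarrow> real) \<Rightarrow> (nat \<Rightarrow> real) \<Rightarrow> nat \<Rightarrow> real \<Rightarrow> (nat \<Rightarrow> real) \<Rightarrow> bool" where
  "ski_alg_defined r b m lam y \<longleftrightarrow>
     (let z = num_ge b m y; k = horizon2 b m lam z; l = horizon1 b m lam z
      in if real z \<ge> real m / 2
         then prob_weights k (buy_weight (r 2) (b 2) k)
         else prob_weights l (buy_weight 1 (b 1) l))"

lemma prob_weights_buy_weight: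
  assumes "0 < \<rho>" "\<rho> \<le> \<beta>" "n \<ge> 1"
  shows "prob_weights n (buy_weight \<rho> \<beta> n)"
proof -
  define a where "a = 1 - \<rho> / \<beta>"
  have \<beta>: "\<beta> > 0" using assms by linarith
  have a: "0 \<le> a" "a < 1" and eq: "(\<beta> - \<rho>) / \<beta> = a" "\<rho> / \<beta> = 1 - a"
    using assms \<beta> by (auto simp: a_def field_simps)
  have an: "a ^ n < 1"
    using a assms(3) by (simp add: power_less_one_iff)
  have w: "buy_weight \<rho> \<beta> n i = a ^ (n - i) * ((1 - a) / (1 - a ^ n))" for i
    unfolding buy_weight_def eq(1) eq(2)[symmetric] a_def by simp
  have "(\<Sum>i=1..n. a ^ (n - i)) = (\<Sum>i<n. a ^ i)"
    by (rule sum.reindex_bij_witness[of _ "\<lambda>i. n - i" "\<lambda>i. n - i"]) auto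
  also have "\<dots> = (1 - a ^ n) / (1 - a)"
    using a by (simp add: sum_gp_strict)
  finally have s: "(\<Sum>i=1..n. a ^ (n - i)) = (1 - a ^ n) / (1 - a)" .
  have "(\<Sum>i=1..n. buy_weight \<rho> \<beta> n i) = 1"
    unfolding w sum_distrib_right[symmetric] s using a an by simp
  moreover have "0 \<le> buy_weight \<rho> \<beta> n i" for i
    unfolding w using a an by simp
  ultimately show ?thesis
    by (simp add: prob_weights_def)
qed

lemma ski_alg_definedI:
  assumes "1 < r 2" "r 2 \<le> b 2" "b 2 < b 1" "0 < lam" "real m + 1 \<le> lam * b 2"
  shows "ski_alg_defined r b m lam y"
proof -
  define z where "z = num_ge b m y"
  have zm: "z \<le> m"
    unfolding z_def num_ge_def by (rule order_trans[OF card_mono[of "{1..m}"]]) auto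
  show ?thesis
  proof (cases "real z \<ge> real m / 2")
    case True
    have "2 * real z - real m + 1 \<le> real m + 1" "2 * real z - real m + 1 > 0"
      using zm True by auto
    then have "1 \<le> lam * b 2 / (2 * real z - real m + 1)"
      using assms by (simp add: field_simps)
    then have "horizon2 b m lam z \<ge> 1"
      unfolding horizon2_def by linarith
    then show ?thesis
      using True assms by (simp add: ski_alg_defined_def Let_def z_def prob_weights_buy_weight)
  next
    case False
    have "(real m - 2 * real z + 1) / lam * b 1 > 0"
      using False assms by simp
    then have "horizon1 b m lam z \<ge> 1"
      unfolding horizon1_def by linarith
    then show ?thesis
      using False assms by (simp add: ski_alg_defined_def Let_def z_def prob_weights_buy_weight)
  qed
qed

end

theory Submission
  imports Defs
begin

text \<open>
  Write \<open>a = 1 - \<rho>/\<beta>\<close>. The weights are chosen so that buying at random within the first \<open>n\<close> days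
  costs exactly \<open>min x n \<cdot> \<rho> / (1 - a\<^sup>n)\<close> in expectation. Combined with \<open>a\<^sup>n \<le> exp (- n\<rho>/\<beta>)\<close> and
  bounds on the horizon \<open>n\<close> this gives robustness. For the bound in terms of the error \<open>\<zeta>\<close>: at
  shop 2 some prediction is at least \<open>b\<^sub>2\<close>, so \<open>OPT + \<zeta> \<ge> b\<^sub>2\<close>; at shop 1 some prediction is
  below \<open>b\<^sub>2\<close>, so \<open>OPT + \<zeta> \<ge> x\<close>.
\<close>

section \<open>Expected cost under the prescribed weights\<close>

lemma
  assumes "prob_weights n w"
  shows pmf_weights_pmf: "pmf (weights_pmf n w) i = (if i \<in> {1..n} then w i else 0)"
    and set_weights_pmf_subset: "set_pmf (weights_pmf n w) \<subseteq> {1..n}"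
proof -
  let ?f = "\<lambda>i. if i \<in> {1..n} then w i else 0"
  have nonneg: "0 \<le> ?f i" for i
    using assms by (auto simp: prob_weights_def)
  have "(\<integral>\<^sup>+i. ennreal (?f i) \<partial>count_space UNIV) = (\<Sum>i\<in>{1..n}. ennreal (?f i))"
    by (rule nn_integral_count_space') auto
  also have "\<dots> = ennreal (\<Sum>i\<in>{1..n}. ?f i)"
    by (rule sum_ennreal) (rule nonneg)
  also have "(\<Sum>i\<in>{1..n}. ?f i) = 1"
    using assms by (simp add: prob_weights_def)
  finally have "pmf (weights_pmf n w) i = ?f i" for i
    unfolding weights_pmf_def using nonneg by (intro pmf_embed_pmf) auto
  then show "pmf (weights_pmf n w) i = ?f i"
    and "set_pmf (weights_pmf n w) \<subseteq> {1..n}"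
    by (auto simp: set_pmf_eq split: if_splits)
qed

lemma prob_weights_nonempty: "prob_weights n w \<Longrightarrow> n \<noteq> 0"
  by (cases n) (auto simp: prob_weights_def)

lemma expected_cost_weights_pmf:
  assumes "prob_weights n w"
  shows "expected_cost r b (map_pmf (\<lambda>j. (s, j)) (weights_pmf n w)) x
    = (\<Sum>j=1..n. w j * ski_cost r b x (s, j))"
proof -
  have "expected_cost r b (map_pmf (\<lambda>j. (s, j)) (weights_pmf n w)) x
      = (\<Sum>j\<in>{1..n}. ski_cost r b x (s, j) * pmf (weights_pmf n w) j)"
    unfolding expected_cost_def integral_map_pmf
    using set_weights_pmf_subset[OF assms] by (intro integral_measure_pmf_real) auto
  then show ?thesis
    by (simp add: pmf_weights_pmf[OF assms] mult.commute)
qed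

text \<open>Raising the horizon by one day scales the old weights by \<open>a\<close> and puts
  weight \<open>1 - a\<close> on the new day. If \<open>x \<le> n\<close>, the new strategy also
  costs \<open>x * r s\<close>, and the value stays put. Otherwise
  \<open>a * n * r s + (1 - a) * (n * r s + b s)\<close> is \<open>(n + 1) * r s\<close> by the
  assumption. The weights here are unnormalised.\<close>

lemma sum_geometric_ski_cost:
  assumes "(1 - a) * b s = r s"
  shows "(\<Sum>j=1..n. a ^ (n - j) * (1 - a) * ski_cost r b x (s, j)) = real (min x n) * r s"
proof (induction n)
  case 0
  show ?case by simp
next
  case (Suc n)
  have "(\<Sum>j=1..Suc n. a ^ (Suc n - j) * (1 - a) * ski_cost r b x (s, j))
      = a * (\<Sum>j=1..n. a ^ (n - j) * (1 - a) * ski_cost r b x (s, j))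
        + (1 - a) * ski_cost r b x (s, Suc n)"
    by (simp add: sum_distrib_left Suc_diff_le mult.assoc)
  also have "\<dots> = real (min x (Suc n)) * r s"
    unfolding Suc.IH using assms
    by (cases "x \<le> n") (auto simp: ski_cost_def algebra_simps)
  finally show ?case .
qed

text \<open>The choice \<open>a = 1 - r s / b s\<close> is the one with
  \<open>(1 - a) * b s = r s\<close>; dividing the geometric identity by the total weight
  \<open>1 - a ^ n\<close> normalises it.\<close>

lemma expected_cost_buy_weight:
  assumes "prob_weights n (buy_weight (r s) (b s) n)" and "0 < b s"
  shows "expected_cost r b (map_pmf (\<lambda>j. (s, j)) (weights_pmf n (buy_weight (r s) (b s) n))) x
    = real (min x n) * r s / (1 - (1 - r s / b s) ^ n)"
proof -
  define a where "a = 1 - r s / b s"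
  have eq: "(b s - r s) / b s = a" "r s / b s = 1 - a" and r: "(1 - a) * b s = r s"
    using assms(2) by (auto simp: a_def field_simps)
  have w: "buy_weight (r s) (b s) n i = a ^ (n - i) * (1 - a) / (1 - a ^ n)" for i
    unfolding buy_weight_def eq(1) a_def using assms(2) by simp
  show ?thesis
    unfolding expected_cost_weights_pmf[OF assms(1)] w a_def[symmetric]
    unfolding sum_geometric_ski_cost[where r=r and b=b and s=s, OF r, symmetric] sum_divide_distrib
    by (intro sum.cong) auto
qed

text \<open>Here the base \<open>a\<close> is negative, so the weights \<open>c\<close> and
  \<open>a * c\<close> of the last two days can both be nonnegative only if \<open>c = 0\<close>,
  which contradicts total weight 1. This settles the case \<open>b 2 < r 2\<close>.\<close>

lemma prob_weights_buy_weight_imp_eq_1: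
  assumes "prob_weights n (buy_weight \<rho> \<beta> n)" and "0 < \<beta>" and "\<beta> < \<rho>"
  shows "n = 1"
proof (rule ccontr)
  assume "n \<noteq> 1"
  define a where "a = 1 - \<rho> / \<beta>"
  define c where "c = \<rho> / (\<beta> * (1 - a ^ n))"
  have a: "a < 0" and w: "buy_weight \<rho> \<beta> n i = a ^ (n - i) * c" for i
    using assms(2,3) by (auto simp: a_def c_def buy_weight_def field_simps)
  have "n \<noteq> 0"
    by (rule prob_weights_nonempty[OF assms(1)])
  with \<open>n \<noteq> 1\<close> have "n \<in> {1..n}" "n - 1 \<in> {1..n}" "n - (n - 1) = 1"
    by auto
  then have "0 \<le> c" "0 \<le> a * c"
    using assms(1) unfolding prob_weights_def w by (metis diff_self_eq_0 mult_1 power_0, metis power_one_right)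
  then have "c = 0"
    using a by (simp add: zero_le_mult_iff)
  then show False
    using assms(1) by (simp add: prob_weights_def w)
qed

section \<open>Exponential estimates\<close>

lemma one_minus_power_le_exp:
  fixes t :: real
  assumes "t \<le> 1"
  shows "(1 - t) ^ n \<le> exp (- t * real n)"
proof -
  have "(1 - t) ^ n \<le> exp (- t) ^ n"
    using assms exp_ge_add_one_self[of "- t"] by (intro power_mono) auto
  then show ?thesis
    by (simp add: exp_of_nat_mult[symmetric] mult.commute)
qed

text \<open>By convexity the exponential lies below its chord over \<open>[-u, 0]\<close>; the chord
  is evaluated at \<open>-s\<close>.\<close>

lemma exp_chord_le:
  fixes s u :: real
  assumes "0 \<le> s" "s \<le> u" "0 < u"
  shows "s * (1 - exp (- u)) \<le> u * (1 - exp (- s))"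
proof -
  have "exp ((1 - s / u) *\<^sub>R 0 + (s / u) *\<^sub>R (- u)) \<le> (1 - s / u) * exp 0 + (s / u) * exp (- u)"
    using assms by (intro convex_onD[OF exp_convex]) auto
  then have "u * exp (- s) \<le> u * ((1 - s / u) + (s / u) * exp (- u))"
    using assms by (intro mult_left_mono) auto
  also have "\<dots> = u - s + s * exp (- u)"
    using assms by (simp add: distrib_left right_diff_distrib)
  finally show ?thesis
    by (simp add: right_diff_distrib)
qed

lemma div_one_minus_exp_mono:
  fixes s u :: real
  assumes "0 < s" "s \<le> u"
  shows "s / (1 - exp (- s)) \<le> u / (1 - exp (- u))"
  using exp_chord_le[of s u] assms by (simp add: field_simps)

lemma one_le_div_one_minus_exp:
  fixes t :: real
  assumes "0 < t"
  shows "1 \<le> t / (1 - exp (- t))"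
  using exp_ge_add_one_self[of "- t"] assms by (simp add: field_simps)

section \<open>Predictions and their error\<close>

lemma num_ge_le: "num_ge b m y \<le> m"
  unfolding num_ge_def by (rule order_trans[OF card_mono[of "{1..m}"]]) auto

lemma prediction_error_ge:
  assumes "i \<in> {1..m}"
  shows "\<bar>y i - real x\<bar> \<le> pred_error m y x"
  unfolding pred_error_def using assms by (intro Max_ge) auto

section \<open>The two ratios and their lower bounds\<close>

locale ski_rental =
  fixes r b :: "nat \<Rightarrow> real" and m :: nat and lam :: real
  assumes r1: "r 1 = 1" and r2: "1 < r 2" and b12: "b 2 < b 1" and b2: "0 < b 2"
    and m: "m \<ge> 1" and lam: "0 < lam" "lam < 1"
    and defined: "\<And>y. predictions m y \<Longrightarrow> ski_alg_defined r b m lam y"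
begin

definition "rob = b 1 / b 2 *
  max (r 2 / (1 - exp (- r 2 * (lam / (real m + 1) - 1 / b 2))))
      (((real m + 1) / lam + 1 / b 1) / (1 - exp (- 1 / lam)))"

definition "con = r 2 * lam / (1 - exp (- r 2 * lam / (real m + 1)))"

text \<open>Otherwise the horizon is \<open>0\<close> when all predictions are at least \<open>b\<^sub>2\<close>.\<close>

lemma lam_b2: "real m + 1 \<le> lam * b 2"
proof -
  define y where "y = (\<lambda>i::nat. b 2 + real i)"
  have "predictions m y"
    by (auto simp: predictions_def y_def strict_mono_on_def)
  moreover have "num_ge b m y = m"
  proof -
    have "{i \<in> {1..m}. b 2 \<le> y i} = {1..m}"
      by (auto simp: y_def)
    then show ?thesis
      by (simp add: num_ge_def)
  qed
  ultimately have "prob_weights (horizon2 b m lam m) (buy_weight (r 2) (b 2) (horizon2 b m lam m))"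
    using defined[of y] by (simp add: ski_alg_defined_def Let_def)
  then have "horizon2 b m lam m \<noteq> 0"
    by (rule prob_weights_nonempty)
  then have "1 \<le> lam * b 2 / (real m + 1)"
    unfolding horizon2_def by (simp add: algebra_simps)
  then show ?thesis
    by (simp add: field_simps)
qed

text \<open>Away from equality \<open>lam_b2\<close> is strict. The denominator of the first
  argument of the maximum in \<open>rob\<close> is then positive.\<close>

lemma exponent_pos:
  assumes "lam * b 2 \<noteq> real m + 1"
  shows "0 < lam / (real m + 1) - 1 / b 2"
proof -
  have "1 / b 2 < lam / (real m + 1)"
    using assms lam_b2 b2 by (simp add: field_simps)
  then show ?thesis by simp
qed

text \<open>With \<open>t = r 2 * lam / (m + 1)\<close>, \<open>con\<close> is \<open>m + 1\<close>
  times \<open>t / (1 - exp (- t))\<close>, a quotient that is at least 1.\<close>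

lemma con_ge_Suc_m: "real m + 1 \<le> con"
proof -
  let ?t = "r 2 * lam / (real m + 1)"
  have "0 < ?t"
    using r2 lam by simp
  moreover have "con = (real m + 1) * (?t / (1 - exp (- ?t)))"
    by (simp add: con_def)
  ultimately show ?thesis
    using mult_left_mono[OF one_le_div_one_minus_exp[of ?t], of "real m + 1"] by simp
qed

lemma one_minus_exp_pos: "0 < 1 - exp (- 1 / lam)"
  using lam by simp

lemma rob_ge_shop2: "r 2 / (1 - exp (- r 2 * (lam / (real m + 1) - 1 / b 2))) \<le> rob"
  and rob_ge_shop1: "b 1 / b 2 * (((real m + 1) / lam + 1 / b 1) / (1 - exp (- 1 / lam))) \<le> rob"
proof -
  let ?M = "max (r 2 / (1 - exp (- r 2 * (lam / (real m + 1) - 1 / b 2))))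
      (((real m + 1) / lam + 1 / b 1) / (1 - exp (- 1 / lam)))"
  have "0 \<le> ((real m + 1) / lam + 1 / b 1) / (1 - exp (- 1 / lam))"
    using lam b12 b2 one_minus_exp_pos by (intro divide_nonneg_pos) auto
  then have M: "0 \<le> ?M" by simp
  have q: "1 \<le> b 1 / b 2" using b12 b2 by simp
  have "?M \<le> rob"
    unfolding rob_def using mult_right_mono[OF q M] by simp
  then show "r 2 / (1 - exp (- r 2 * (lam / (real m + 1) - 1 / b 2))) \<le> rob" by simp
  show "b 1 / b 2 * (((real m + 1) / lam + 1 / b 1) / (1 - exp (- 1 / lam))) \<le> rob"
    unfolding rob_def using q by (intro mult_left_mono) auto
qed

text \<open>
  If \<open>lam * b 2 = m + 1\<close>, the first argument of the maximum in \<open>rob\<close> is a division by zero, that is,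
  \<open>0\<close>, so the second one has to give the bound.
\<close>

lemma b2_le_rob:
  assumes "lam * b 2 = real m + 1"
  shows "b 2 \<le> rob"
proof -
  let ?t = "(real m + 1) / lam + 1 / b 1"
  have "b 2 = (real m + 1) / lam"
    using assms lam by (simp add: field_simps)
  also have "\<dots> \<le> ?t"
    using b12 b2 by simp
  finally have t: "b 2 \<le> ?t" .
  also have "?t \<le> ?t / (1 - exp (- 1 / lam))"
    using t b2 one_minus_exp_pos by (intro mult_imp_le_div_pos mult_left_le) auto
  finally have "1 * b 2 \<le> b 1 / b 2 * (?t / (1 - exp (- 1 / lam)))"
    using b12 b2 by (intro mult_mono) auto
  then show ?thesis
    using rob_ge_shop1 by linarith
qed

section \<open>Cost bounds for a fixed prediction vector\<close>

context
  fixes y :: "nat \<Rightarrow> real"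
  assumes y: "predictions m y"
begin

lemma expected_cost_bounds_shop2:
  assumes z: "real (num_ge b m y) \<ge> real m / 2"
  shows "expected_cost r b (ski_alg r b m lam y) x \<le> rob * ski_opt b x"
    and "expected_cost r b (ski_alg r b m lam y) x \<le> con * (ski_opt b x + pred_error m y x)"
proof -
  define z where "z = num_ge b m y"
  define c where "c = 2 * real z - real m + 1"
  define k where "k = horizon2 b m lam z"
  define a where "a = 1 - r 2 / b 2"
  have P: "prob_weights k (buy_weight (r 2) (b 2) k)"
    using defined[OF y] z by (simp add: ski_alg_defined_def Let_def k_def z_def)
  have E: "expected_cost r b (ski_alg r b m lam y) x = real (min x k) * (r 2 / (1 - a ^ k))" for x
    using z expected_cost_buy_weight[where r=r and b=b and s=2, OF P b2, of x]
    by (simp add: ski_alg_def Let_def k_def z_def a_def)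
  \<comment> \<open>The lower bound on \<open>c\<close> limits \<open>k\<close> from above, as the
    bound by \<open>con\<close> requires; the upper bound on \<open>c\<close> keeps \<open>k\<close>
    large enough for \<open>rob\<close>.\<close>
  have c: "1 \<le> c" "c \<le> real m + 1"
    using assms num_ge_le[of b m y] by (auto simp: c_def z_def)
  have "k \<noteq> 0"
    by (rule prob_weights_nonempty[OF P])
  have k: "real k \<le> lam * b 2 / c" "lam * b 2 / c - 1 \<le> real k"
    using \<open>k \<noteq> 0\<close> unfolding k_def horizon2_def c_def by linarith+
  have "lam * b 2 / c \<le> lam * b 2"
    using c lam b2 by (simp add: field_simps)
  with k have k_le: "real k \<le> lam * b 2" by linarith
  then have k_le_b2: "real k \<le> b 2"
    using lam b2 by (smt (verit) mult_le_cancel_right1)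
  have "lam * b 2 / (real m + 1) \<le> lam * b 2 / c"
    using c lam b2 by (intro divide_left_mono) auto
  with k have "lam * b 2 / (real m + 1) - 1 \<le> real k" by linarith
  then have "(lam * b 2 / (real m + 1) - 1) / b 2 \<le> real k / b 2"
    using b2 by (intro divide_right_mono) auto
  then have k_ge: "lam / (real m + 1) - 1 / b 2 \<le> real k / b 2"
    using b2 by (simp add: diff_divide_distrib)

  have ratio: "0 \<le> r 2 / (1 - a ^ k) \<and> r 2 / (1 - a ^ k) \<le> rob
      \<and> real k * (r 2 / (1 - a ^ k)) \<le> con * b 2"
  proof (cases "r 2 \<le> b 2")
    case True
    have a: "0 \<le> a" "a < 1" using True r2 b2 by (auto simp: a_def)
    have ak: "a ^ k \<le> exp (- (r 2 / b 2) * real k)"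
      unfolding a_def using True b2 by (intro one_minus_power_le_exp) simp
    have ak1: "a ^ k \<le> a"
      using a \<open>k \<noteq> 0\<close> by (simp add: power_le_one_iff power_decreasing[of 1 k a, simplified])
    \<comment> \<open>When \<open>lam * b 2 = m + 1\<close> the exponent in \<open>rob\<close>
      vanishes, so the exponential estimate is replaced by \<open>a ^ k \<le> a\<close>, which
      bounds the quotient by \<open>b 2\<close>.\<close>
    have "r 2 / (1 - a ^ k) \<le> rob"
    proof (cases "lam * b 2 = real m + 1")
      case True
      have "r 2 / (1 - a ^ k) \<le> r 2 / (1 - a)"
        using ak1 a r2 by (intro divide_left_mono mult_pos_pos) auto
      also have "\<dots> = b 2"
        using r2 b2 by (simp add: a_def)
      finally show ?thesis
        using b2_le_rob[OF True] by linarith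
    next
      case False
      then have "0 < lam / (real m + 1) - 1 / b 2"
        by (rule exponent_pos)
      then have pos: "0 < 1 - exp (- r 2 * (lam / (real m + 1) - 1 / b 2))"
        using r2 by simp
      have "r 2 * (lam / (real m + 1) - 1 / b 2) \<le> r 2 * (real k / b 2)"
        using k_ge r2 by (intro mult_left_mono) auto
      then have "exp (- (r 2 / b 2) * real k) \<le> exp (- r 2 * (lam / (real m + 1) - 1 / b 2))"
        by simp
      with ak have "a ^ k \<le> exp (- r 2 * (lam / (real m + 1) - 1 / b 2))"
        by linarith
      then have "r 2 / (1 - a ^ k) \<le> r 2 / (1 - exp (- r 2 * (lam / (real m + 1) - 1 / b 2)))"
        using pos r2 by (intro divide_left_mono mult_pos_pos) linarith+
      then show ?thesis
        using rob_ge_shop2 by linarith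
    qed
    moreover have "real k * (r 2 / (1 - a ^ k)) \<le> con * b 2"
    proof -
      \<comment> \<open>The exponent in \<open>a ^ k \<le> exp (- ?s)\<close>, for which
        \<open>k * r 2 = b 2 * ?s\<close>; monotonicity of \<open>s / (1 - exp (- s))\<close> then
        allows \<open>?s\<close> to be raised to \<open>r 2 * lam\<close>.\<close>
      let ?s = "r 2 / b 2 * real k"
      have s: "0 < ?s" "?s \<le> r 2 * lam"
        using k_le r2 b2 \<open>k \<noteq> 0\<close> by (auto simp: field_simps)
      have "real k * (r 2 / (1 - a ^ k)) = b 2 * (?s / (1 - a ^ k))"
        using b2 by simp
      also have "?s / (1 - a ^ k) \<le> ?s / (1 - exp (- ?s))"
        using ak s ak1 a by (intro divide_left_mono mult_pos_pos) auto
      also have "\<dots> \<le> r 2 * lam / (1 - exp (- (r 2 * lam)))"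
        by (rule div_one_minus_exp_mono[OF s])
      also have "\<dots> \<le> con"
        unfolding con_def using r2 lam m
        by (intro divide_left_mono mult_pos_pos) (auto simp: divide_le_eq algebra_simps)
      finally show ?thesis
        using b2 by (simp add: mult.commute)
    qed
    ultimately show ?thesis
      using ak1 a r2 by simp
  next
    case False
    \<comment> \<open>All the weight sits on day 1, so the quotient is the purchase price
      \<open>b 2\<close>. Off the boundary it is below \<open>r 2\<close>, hence below the first
      argument of the maximum.\<close>
    then have "k = 1"
      using prob_weights_buy_weight_imp_eq_1[OF P b2] by simp
    then have r: "r 2 / (1 - a ^ k) = b 2"
      using r2 b2 by (simp add: a_def)
    have "b 2 \<le> rob"
    proof (cases "lam * b 2 = real m + 1")
      case True
      then show ?thesis by (rule b2_le_rob)
    next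
      case neq: False
      then have "0 < lam / (real m + 1) - 1 / b 2"
        by (rule exponent_pos)
      then have "r 2 \<le> r 2 / (1 - exp (- r 2 * (lam / (real m + 1) - 1 / b 2)))"
        using r2 by (intro mult_imp_le_div_pos mult_left_le) auto
      then show ?thesis
        using rob_ge_shop2 False by linarith
    qed
    moreover have "b 2 \<le> con * b 2"
      using con_ge_Suc_m b2 by simp
    ultimately show ?thesis
      using r b2 \<open>k = 1\<close> by simp
  qed

  have "real (min x k) \<le> ski_opt b x"
    using k_le_b2 by (auto simp: ski_opt_def)
  then show "expected_cost r b (ski_alg r b m lam y) x \<le> rob * ski_opt b x"
    unfolding E using ratio mult_mono[of "real (min x k)" "ski_opt b x" "r 2 / (1 - a ^ k)" rob]
    by (simp add: mult.commute)

  have "num_ge b m y \<noteq> 0"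
    using z m by auto
  then have "{i \<in> {1..m}. b 2 \<le> y i} \<noteq> {}"
    unfolding num_ge_def by (metis card.empty)
  then obtain i where i: "i \<in> {1..m}" "b 2 \<le> y i"
    by blast
  have "b 2 \<le> ski_opt b x + pred_error m y x"
    using prediction_error_ge[OF i(1), of y x] i(2) by (auto simp: ski_opt_def)
  then have "con * b 2 \<le> con * (ski_opt b x + pred_error m y x)"
    using con_ge_Suc_m by (intro mult_left_mono) auto
  moreover have "real (min x k) * (r 2 / (1 - a ^ k)) \<le> real k * (r 2 / (1 - a ^ k))"
    using ratio by (intro mult_right_mono) auto
  ultimately show
    "expected_cost r b (ski_alg r b m lam y) x \<le> con * (ski_opt b x + pred_error m y x)"
    unfolding E using ratio by linarith
qed

lemma expected_cost_bounds_shop1: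
  assumes z: "\<not> real (num_ge b m y) \<ge> real m / 2"
  shows "expected_cost r b (ski_alg r b m lam y) x \<le> rob * ski_opt b x"
    and "expected_cost r b (ski_alg r b m lam y) x \<le> con * (ski_opt b x + pred_error m y x)"
proof -
  define z where "z = num_ge b m y"
  define d where "d = real m - 2 * real z + 1"
  define l where "l = horizon1 b m lam z"
  define a where "a = 1 - 1 / b 1"
  \<comment> \<open>From \<open>lam_b2\<close> and \<open>lam < 1\<close> even \<open>b 2\<close>
    exceeds 1.\<close>
  have b1: "1 < b 1"
    using lam_b2 b12 b2 lam by (smt (verit) mult_le_cancel_right1 of_nat_0_le_iff)
  have P: "prob_weights l (buy_weight (r 1) (b 1) l)"
    using defined[OF y] z by (simp add: ski_alg_defined_def Let_def l_def z_def r1[simplified])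
  have E: "expected_cost r b (ski_alg r b m lam y) x = real (min x l) * (1 / (1 - a ^ l))" for x
    using z expected_cost_buy_weight[where r=r and b=b and s=1, OF P, of x] b1
    by (simp add: ski_alg_def Let_def l_def z_def a_def r1[simplified])
  \<comment> \<open>Stated over the naturals, so that \<open>m - 2 * z\<close> is at least 1 and
    hence \<open>d\<close> at least 2.\<close>
  have "2 * z < m"
    using assms unfolding z_def by linarith
  then have d: "2 \<le> d" "d \<le> real m + 1"
    unfolding d_def by linarith+
  have "d / lam * b 1 > 0"
    using d lam b1 by simp
  then have l: "d / lam * b 1 \<le> real l" "real l \<le> d / lam * b 1 + 1"
    unfolding l_def horizon1_def d_def[symmetric] by linarith+
  have "2 / lam * b 1 \<le> d / lam * b 1" "d / lam * b 1 \<le> (real m + 1) / lam * b 1"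
    using d lam b1 by (auto intro!: mult_right_mono divide_right_mono)
  with l have l_ge: "2 / lam \<le> real l / b 1" and l_le: "real l \<le> (real m + 1) / lam * b 1 + 1"
    using b1 by (auto simp: field_simps)
  have "a ^ l \<le> exp (- (1 / b 1) * real l)"
    unfolding a_def using b1 by (intro one_minus_power_le_exp) simp
  also have "\<dots> \<le> exp (- (2 / lam))"
    using l_ge by simp
  finally have al: "a ^ l \<le> exp (- (2 / lam))" .
  have "exp (- (2 / lam)) \<le> exp (- 1 / lam)"
    using lam by (simp add: field_simps)
  with al have al_lam: "a ^ l \<le> exp (- 1 / lam)" by linarith
  have "exp (- (2 / lam)) \<le> exp (- 1 :: real)"
    using lam by (simp add: field_simps)
  also have "\<dots> \<le> 1 / 2"
    using exp_ge_add_one_self[of "1 :: real"] by (simp add: exp_minus field_simps)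
  finally have al_half: "a ^ l \<le> 1 / 2"
    using al by linarith
  \<comment> \<open>The normalisation costs at most a factor
    \<open>2 \<le> m + 1 \<le> con\<close>.\<close>
  have "1 / (1 - a ^ l) \<le> 2"
    using al_half by (simp add: field_simps)
  then have ratio: "1 / (1 - a ^ l) \<le> con"
    using con_ge_Suc_m m by linarith
  define e where "e = 1 - exp (- 1 / lam)"
  have e: "0 < e" "e \<le> 1" "1 / (1 - a ^ l) \<le> 1 / e"
    using al_lam al_half one_minus_exp_pos
    by (auto simp: e_def intro!: divide_left_mono mult_pos_pos)

  \<comment> \<open>If \<open>x \<le> b 2\<close>, then \<open>OPT = x\<close> and
    \<open>b 2\<close> is below the factor; otherwise \<open>OPT = b 2\<close> and \<open>l\<close>
    is below the factor.\<close>
  have "real (min x l) * b 2 \<le> ((real m + 1) / lam * b 1 + 1) * ski_opt b x"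
  proof (cases "real x \<le> b 2")
    case True
    have "1 * b 1 \<le> (real m + 1) / lam * b 1"
      using lam b1 by (intro mult_right_mono) (auto simp: field_simps)
    then have "b 2 \<le> (real m + 1) / lam * b 1 + 1"
      using b12 by simp
    then show ?thesis
      using True b2 mult_mono[of "b 2" "(real m + 1) / lam * b 1 + 1" "real (min x l)" "real x"]
      by (simp add: ski_opt_def mult.commute)
  next
    case False
    have "real (min x l) \<le> real l" by simp
    also note l_le
    finally show ?thesis
      using False b2 by (simp add: ski_opt_def)
  qed
  then have "real (min x l) \<le> ((real m + 1) / lam * b 1 + 1) / b 2 * ski_opt b x"
    using b2 by (simp add: field_simps)
  \<comment> \<open>The \<open>+ 1\<close> from rounding up the horizon becomes the term
    \<open>1 / b 1\<close> of \<open>rob\<close>.\<close>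
  also have "((real m + 1) / lam * b 1 + 1) / b 2 = b 1 / b 2 * ((real m + 1) / lam + 1 / b 1)"
    using b1 b2 lam by (simp add: field_simps)
  finally have "real (min x l) * (1 / (1 - a ^ l))
      \<le> b 1 / b 2 * ((real m + 1) / lam + 1 / b 1) * ski_opt b x * (1 / e)"
    using e al_half by (intro mult_mono) auto
  also have "\<dots> = b 1 / b 2 * (((real m + 1) / lam + 1 / b 1) / e) * ski_opt b x"
    by simp
  also have "\<dots> \<le> rob * ski_opt b x"
    using rob_ge_shop1 b2 by (intro mult_right_mono) (auto simp: e_def ski_opt_def)
  finally show "expected_cost r b (ski_alg r b m lam y) x \<le> rob * ski_opt b x"
    unfolding E .

  obtain i where i: "i \<in> {1..m}" "y i < b 2"
  proof (rule ccontr)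
    assume "\<not> thesis"
    then have "{i \<in> {1..m}. b 2 \<le> y i} = {1..m}"
      using that by force
    then have "num_ge b m y = m"
      by (simp add: num_ge_def)
    then show False using assms by simp
  qed
  have "real (min x l) \<le> real x" by simp
  also have "real x \<le> ski_opt b x + pred_error m y x"
    using prediction_error_ge[OF i(1), of y x] i(2) by (auto simp: ski_opt_def)
  finally have "real (min x l) * (1 / (1 - a ^ l)) \<le> (ski_opt b x + pred_error m y x) * con"
    using ratio al_half by (intro mult_mono) auto
  then show "expected_cost r b (ski_alg r b m lam y) x \<le> con * (ski_opt b x + pred_error m y x)"
    unfolding E by (simp add: mult.commute)
qed

lemmas expected_cost_le_rob = expected_cost_bounds_shop1(1) expected_cost_bounds_shop2(1)
lemmas expected_cost_le_con = expected_cost_bounds_shop1(2) expected_cost_bounds_shop2(2)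

end

end

section \<open>Competitive ratio, consistency and robustness\<close>

theorem theorem4:
  fixes r b :: "nat \<Rightarrow> real" and m :: nat and lam :: real
  assumes "r 1 = 1" and "1 < r 2"
    and "b 2 < b 1" and "0 < b 2"
    and "m \<ge> 1"
    and "0 < lam" and "lam < 1"
    and "\<And>y. predictions m y \<Longrightarrow> ski_alg_defined r b m lam y"
  shows "let A = ski_alg r b m lam;
             rob = b 1 / b 2 *
               max (r 2 / (1 - exp (- r 2 * (lam / (real m + 1) - 1 / b 2))))
                   (((real m + 1) / lam + 1 / b 1) / (1 - exp (- 1 / lam)));
             con = r 2 * lam / (1 - exp (- r 2 * lam / (real m + 1)))
         in (\<forall>x y. x \<ge> 1 \<longrightarrow> predictions m y \<longrightarrow>
               expected_cost r b (A y) x / ski_opt b x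
                 \<le> min rob (con * (1 + pred_error m y x / ski_opt b x)))
            \<and> consistent r b m A con
            \<and> robust r b m A rob"
proof -
  interpret ski_rental r b m lam
    using assms by unfold_locales auto
  let ?A = "ski_alg r b m lam"
  have R: "expected_cost r b (?A y) x \<le> rob * ski_opt b x" if "predictions m y" for x y
    using expected_cost_le_rob[OF that] by blast
  have C: "expected_cost r b (?A y) x \<le> con * (ski_opt b x + pred_error m y x)"
    if "predictions m y" for x y
    using expected_cost_le_con[OF that] by blast
  have "expected_cost r b (?A y) x / ski_opt b x
      \<le> min rob (con * (1 + pred_error m y x / ski_opt b x))"
    if "predictions m y" "x \<ge> 1" for x y
  proof -
    \<comment> \<open>Passing to quotients takes \<open>x \<ge> 1\<close>; the product forms
      \<open>R\<close> and \<open>C\<close> also cover \<open>x = 0\<close>.\<close>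
    have "0 < ski_opt b x"
      using that(2) assms(4) by (simp add: ski_opt_def)
    then show ?thesis
      using R[OF that(1), of x] C[OF that(1), of x] by (simp add: field_simps)
  qed
  moreover have "consistent r b m ?A con"
    unfolding consistent_def
    using C by (metis add_0_right)
  moreover have "robust r b m ?A rob"
    using R by (simp add: robust_def)
  ultimately show ?thesis
    unfolding Let_def rob_def con_def by blast
qed

end
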